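(* Let $\mathbb{K}$ be a field, $n\ge 1$ an integer, $<$ an admissible monomial order on the monoid $[\mathbf{x}]$ of monomials in $x_1,\dots,x_n$, and $R=\{s_1,\dots,s_r\}\subseteq \mathbb{K}[[\mathbf{x}]]\setminus\{0\}$ a set of exactly $r\geq 0$ non-zero formal power series. Assume that $<$ is compatible with the degree. Let $\mathfrak{X}=(\mathbb{K}[[\mathbf{x}]],\tau_\delta,\to)$ be the topological rewriting system induced by $R$ and $<$. Then the following statements are equivalent: 1. The system $\mathfrak{X}$ is finitary topologically confluent. 2. For all $f\in I(R)$, we have $f\xrightarrow{\mathrm{top}}0$. 3. Every $f\in I(R)\setminus\{0\}$ is reducible (i.e. is not a normal form of $\mathfrak{X}$). 4. The set $R$ is a standard basis of $I(R)$ for $<$. 5. For all $f\in I(R)$, we have $f\xrightarrow{\mathrm{ch}}0$. 6. Every $f\in I(R)\setminus\{0\}$ admits a standard representation with respect to $R$ and $<$. 7. For all $f\in\mathbb{K}[[\mathbf{x}]]$, there is a unique $\alpha\in\mathrm{NF}(\mathfrak{X})$ such that $f=\alpha+\sum_{i=1}^r q_is_i$ for some $(q_1,\dots,q_r)\in\mathbb{K}[[\mathbf{x}]]^r$. 8. The map from $\mathrm{NF}(\mathfrak{X})$ to the quotient $\mathbb{K}[[\mathbf{x}]]/I(R)$ which sends any normal form $\alpha$ to the class $\alpha+I(R)$ is bijective. 9. The system $\mathfrak{X}$ is infinitary topologically confluent.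
   Context: Formal power series. $[\mathbf{x}]$ is the free commutative monoid on the distinct indeterminates $x_1,\dots,x_n$; its elements are called monomials, $1$ is the empty monomial, and $\deg(x_1^{\mu_1}\cdots x_n^{\mu_n})=\mu_1+\cdots+\mu_n$. $\mathbb{K}[[\mathbf{x}]]=\mathbb{K}[[x_1,\dots,x_n]]$ is the algebra of formal power series; $\langle f\mid m\rangle$ is the coefficient of the monomial $m$ in $f$ and $\mathrm{supp}(f)=\{m:\langle f\mid m\rangle\neq 0\}$. The metric $\delta$ is $\delta(f,g)=2^{-\mathrm{val}(f-g)}$, where $\mathrm{val}(h)$ is the smallest degree of a monomial in $\mathrm{supp}(h)$ if $h\ne0$, $\mathrm{val}(0)=\infty$ and $2^{-\infty}=0$; $\tau_\delta$ is the induced topology and all limits are taken in it. Monomial orders. A monomial order is a total order $\le$ on $[\mathbf{x}]$ such that $m_1\le m_2$ implies $m m_1\le m m_2$ for all monomials $m,m_1,m_2$. It is admissible if $1\le m$ for all $m$; it is compatible with the degree if $\deg(m_1)<\deg(m_2)$ implies $m_1<m_2$. For $f\neq0$, $\mathrm{lm}(f)=\min_<\mathrm{supp}(f)$ and $\mathrm{lc}(f)=\langle f\mid \mathrm{lm}(f)\rangle$. The rewriting system. $I(R)$ is the ideal of $\mathbb{K}[[\mathbf{x}]]$ generated by $R$. Write $f\to g$ if there exist $M\in\mathrm{supp}(f)$, $i\in\{1,\dots,r\}$ and $m\in[\mathbf{x}]$ with $M=m\cdot\mathrm{lm}(s_i)$ and $g=f-\frac{\langle f\mid M\rangle}{\mathrm{lc}(s_i)}\,m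 s_i$. A normal form is an $f$ for which there is no $g$ with $f\to g$; $\mathrm{NF}(\mathfrak{X})$ is the set of normal forms. $\xrightarrow{=}$ and $\xrightarrow{\star}$ denote the reflexive closure and the transitive reflexive closure of $\to$. Topological rewriting relation: $f\xrightarrow{\mathrm{top}}g$ means that $(f,g)$ is in the closure of the relation $\xrightarrow{\star}$, viewed as a subset of $\mathbb{K}[[\mathbf{x}]]\times\mathbb{K}[[\mathbf{x}]]$ with the product of the discrete topology (first factor) and $\tau_\delta$ (second factor). Topological rewriting with chains: $f\xrightarrow{\mathrm{ch}}g$ means that there is a sequence $(h_k)_{k\in\mathbb{N}}$ with $h_0=f$, $h_k\xrightarrow{=}h_{k+1}$ for all $k$, and $\lim_{k\to\infty}h_k=g$. Confluence. The system is finitary topologically confluent if whenever $a\xrightarrow{\star}b$ and $a\xrightarrow{\star}c$, there is $d$ with $b\xrightarrow{\mathrm{top}}d$ and $c\xrightarrow{\mathrm{top}}d$. It is infinitary topologically confluent if whenever $a\xrightarrow{\mathrm{top}}b$ and $a\xrightarrow{\mathrm{top}}c$, there is $d$ with $b\xrightarrow{\mathrm{top}}d$ and $c\xrightarrow{\mathrm{top}}d$. Standard bases. A standard basis of an ideal $I$ for $<$ is a set $G\subseteq I\setminus\{0\}$ such that for every $f\in I\setminus\{0\}$ there are $g\in G$ and $m\in[\mathbf{x}]$ with $\mathrm{lm}(f)=m\cdot\mathrm{lm}(g)$. A non-zero $f$ admits a standard representation with respect to $R$ and $<$ if there is $(q_1,\dots,q_r)\in\mathbb{K}[[\mathbf{x}]]^r$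 with $f=\sum_{i=1}^rq_is_i$ and $\mathrm{lm}(f)=\min_<\{\mathrm{lm}(q_is_i):1\le i\le r,\ q_i\ne0\}$. *)

theory Defs
  imports "HOL-Analysis.Analysis" "HOL-Library.Multiset" "HOL-Algebra.Algebraic_Closure_Type"
begin

section \<open>Multivariate formal power series\<close>

text \<open>
  The free commutative monoid on the indeterminates, which are indexed by \<open>'n\<close>, is the type
  \<open>'n multiset\<close>, written additively: the product of monomials is \<open>+\<close>, the empty monomial is
  \<open>{#}\<close>, and the degree of a monomial is its \<^const>\<open>size\<close>.
\<close>

typedef ('n, 'k) mfps = "UNIV :: ('n multiset \<Rightarrow> 'k) set"
  morphisms mcoeff Abs_mfps
  by simp

setup_lifting type_definition_mfps

lemma mfps_eqI: "(\<And>m. mcoeff f m = mcoeff g m) \<Longrightarrow> f = g"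
  by transfer auto

lemma finite_splits: "finite {(a, b). a + b = (m :: 'n multiset)}"
proof (rule finite_subset)
  show "{(a, b). a + b = m} \<subseteq> (\<lambda>a. (a, m - a)) ` {a. a \<subseteq># m}"
    by force
  have "{a. a \<subseteq># m} \<subseteq> mset ` {xs. set xs \<subseteq> set_mset m \<and> length xs \<le> size m}"
  proof
    fix a assume "a \<in> {a. a \<subseteq># m}"
    moreover obtain xs where "mset xs = a"
      using ex_mset by blast
    ultimately show "a \<in> mset ` {xs. set xs \<subseteq> set_mset m \<and> length xs \<le> size m}"
      by (force dest: set_mset_mono size_mset_mono)
  qed
  then show "finite ((\<lambda>a. (a, m - a)) ` {a. a \<subseteq># m})"
    by (intro finite_imageI)
      (rule finite_subset, assumption, simp add: finite_lists_length_le)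
qed

instantiation mfps :: (type, zero) zero
begin
lift_definition zero_mfps :: "('a, 'b) mfps" is "\<lambda>_. 0" .
instance ..
end

instantiation mfps :: (type, ab_group_add) ab_group_add
begin
lift_definition plus_mfps :: "('a, 'b) mfps \<Rightarrow> ('a, 'b) mfps \<Rightarrow> ('a, 'b) mfps"
  is "\<lambda>f g m. f m + g m" .
lift_definition minus_mfps :: "('a, 'b) mfps \<Rightarrow> ('a, 'b) mfps \<Rightarrow> ('a, 'b) mfps"
  is "\<lambda>f g m. f m - g m" .
lift_definition uminus_mfps :: "('a, 'b) mfps \<Rightarrow> ('a, 'b) mfps"
  is "\<lambda>f m. - f m" .
instance
  by standard (transfer; auto simp: algebra_simps fun_eq_iff)+
end

instantiation mfps :: (type, comm_ring_1) comm_ring_1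
begin

lift_definition one_mfps :: "('a, 'b) mfps" is "\<lambda>m. if m = {#} then 1 else 0" .

lift_definition times_mfps :: "('a, 'b) mfps \<Rightarrow> ('a, 'b) mfps \<Rightarrow> ('a, 'b) mfps"
  is "\<lambda>f g m. \<Sum>(a, b) \<in> {(a, b). a + b = m}. f a * g b" .

instance
proof
  fix f g h :: "('a, 'b) mfps"
  show "f * g = g * f" for f g :: "('a, 'b) mfps"
    by (transfer, rule ext, rule sum.reindex_bij_witness[where i = prod.swap and j = prod.swap])
      (auto simp: algebra_simps)
  show "f * g * h = f * (g * h)"
  proof (rule mfps_eqI)
    fix m
    let ?S = "\<lambda>m :: 'a multiset. {(a, b). a + b = m}"
    have "mcoeff (f * g * h) m
        = (\<Sum>(u, c) \<in> ?S m. \<Sum>(a, b) \<in> ?S u. mcoeff f a * mcoeff g b * mcoeff h c)"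
      by (simp add: times_mfps.rep_eq sum_distrib_right case_prod_unfold)
    also have "\<dots> = (\<Sum>((u, c), (a, b)) \<in> (SIGMA x : ?S m. ?S (fst x)).
        mcoeff f a * mcoeff g b * mcoeff h c)"
      by (subst sum.Sigma[symmetric])
        (auto simp: finite_splits[unfolded case_prod_unfold] case_prod_unfold)
    also have "\<dots> = (\<Sum>((a, v), (b, c)) \<in> (SIGMA x : ?S m. ?S (snd x)).
        mcoeff f a * (mcoeff g b * mcoeff h c))"
      by (rule sum.reindex_bij_witness
            [where j = "\<lambda>((u, c), (a, b)). ((a, b + c), (b, c))"
               and i = "\<lambda>((a, v), (b, c)). ((a + b, c), (a, b))"])
        (auto simp: algebra_simps)
    also have "\<dots> = (\<Sum>(a, v) \<in> ?S m. \<Sum>(b, c) \<in> ?S v. mcoeff f a * (mcoeff g b * mcoeff h c))"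
      by (subst sum.Sigma[symmetric])
        (auto simp: finite_splits[unfolded case_prod_unfold] case_prod_unfold)
    also have "\<dots> = mcoeff (f * (g * h)) m"
      by (simp add: times_mfps.rep_eq sum_distrib_left case_prod_unfold)
    finally show "mcoeff (f * g * h) m = mcoeff (f * (g * h)) m" .
  qed
  show "1 * f = f"
  proof (rule mfps_eqI)
    fix m
    have "mcoeff (1 * f) m = (\<Sum>(a, b) \<in> {({#}, m)}. mcoeff 1 a * mcoeff f b)"
      unfolding times_mfps.rep_eq
      by (rule sum.mono_neutral_right) (auto simp: finite_splits one_mfps.rep_eq split: if_splits)
    then show "mcoeff (1 * f) m = mcoeff f m"
      by (simp add: one_mfps.rep_eq)
  qed
  show "(f + g) * h = f * h + g * h"
    by transfer (simp add: algebra_simps sum.distrib case_prod_unfold)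
  show "(0 :: ('a, 'b) mfps) \<noteq> 1"
    by transfer (auto dest: fun_cong[of _ _ "{#}"])
qed

end

lift_definition msingle :: "'n multiset \<Rightarrow> 'k \<Rightarrow> ('n, 'k :: zero) mfps"
  is "\<lambda>m c m'. if m' = m then c else 0" .

definition supp :: "('n, 'k :: zero) mfps \<Rightarrow> 'n multiset set" where
  "supp f = {m. mcoeff f m \<noteq> 0}"

text \<open>Only used for non-zero arguments.\<close>
definition mval :: "('n, 'k :: zero) mfps \<Rightarrow> nat" where
  "mval f = (LEAST d. \<exists>m \<in> supp f. size m = d)"

lemma supp_empty_iff: "supp f = {} \<longleftrightarrow> f = 0"
  unfolding supp_def by transfer auto

lemma mval_le: "m \<in> supp f \<Longrightarrow> mval f \<le> size m"
  unfolding mval_def by (rule Least_le) auto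

lemma mval_attained: "f \<noteq> 0 \<Longrightarrow> \<exists>m \<in> supp f. size m = mval f"
  unfolding mval_def by (rule LeastI_ex) (use supp_empty_iff[of f] in auto)

instantiation mfps :: (type, ab_group_add) metric_space
begin

definition dist_mfps :: "('a, 'b) mfps \<Rightarrow> ('a, 'b) mfps \<Rightarrow> real" where
  "dist_mfps f g = (if f = g then 0 else inverse (2 ^ mval (f - g)))"

definition uniformity_mfps :: "(('a, 'b) mfps \<times> ('a, 'b) mfps) filter" where
  "uniformity_mfps = (INF e \<in> {0<..}. principal {(x, y). dist x y < e})"

definition open_mfps :: "('a, 'b) mfps set \<Rightarrow> bool" where
  "open_mfps U \<longleftrightarrow> (\<forall>x \<in> U. eventually (\<lambda>(x', y). x' = x \<longrightarrow> y \<in> U) uniformity)"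

instance
proof
  fix f g h :: "('a, 'b) mfps"
  show "dist f g = 0 \<longleftrightarrow> f = g"
    by (simp add: dist_mfps_def)
  have *: "mval (f - h) \<le> mval (f - g) \<or> mval (g - h) \<le> mval (f - g)" if neq: "f \<noteq> g"
  proof -
    obtain m where m: "m \<in> supp (f - g)" "size m = mval (f - g)"
      using mval_attained[of "f - g"] neq by auto
    then have "m \<in> supp (f - h) \<or> m \<in> supp (g - h)"
      by (auto simp: supp_def minus_mfps.rep_eq)
    with m(2) show ?thesis
      using mval_le[of m "f - h"] mval_le[of m "g - h"] by auto
  qed
  have nonneg: "0 \<le> dist a b" for a b :: "('a, 'b) mfps"
    by (simp add: dist_mfps_def)
  have le: "inverse (2 ^ i :: real) \<le> inverse (2 ^ j)" if "j \<le> i" for i j :: nat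
    using that by (simp add: power_increasing le_imp_inverse_le)
  show "dist f g \<le> dist f h + dist g h"
  proof (cases "f = g \<or> f = h \<or> g = h")
    case True
    have "supp (h - g) = supp (g - h)"
      by (auto simp: supp_def minus_mfps.rep_eq)
    then have "mval (h - g) = mval (g - h)"
      by (simp add: mval_def)
    with True show ?thesis
      by (elim disjE) (simp_all add: dist_mfps_def)
  next
    case False
    with * le have "dist f g \<le> dist f h \<or> dist f g \<le> dist g h"
      unfolding dist_mfps_def by metis
    then show ?thesis
      using nonneg[of f h] nonneg[of g h] by linarith
  qed
qed (simp_all add: uniformity_mfps_def open_mfps_def)

end


section \<open>Monomial orders\<close>

definition monomial_order :: "('n multiset \<Rightarrow> 'n multiset \<Rightarrow> bool) \<Rightarrow> bool" where
  "monomial_order leq \<longleftrightarrow>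
     linear_order_on UNIV {(m1, m2). leq m1 m2} \<and>
     (\<forall>m m1 m2. leq m1 m2 \<longrightarrow> leq (m + m1) (m + m2))"

definition admissible :: "('n multiset \<Rightarrow> 'n multiset \<Rightarrow> bool) \<Rightarrow> bool" where
  "admissible leq \<longleftrightarrow> (\<forall>m. leq {#} m)"

definition degree_compatible :: "('n multiset \<Rightarrow> 'n multiset \<Rightarrow> bool) \<Rightarrow> bool" where
  "degree_compatible leq \<longleftrightarrow> (\<forall>m1 m2. size m1 < size m2 \<longrightarrow> leq m1 m2 \<and> m1 \<noteq> m2)"

definition min_monomial ::
    "('n multiset \<Rightarrow> 'n multiset \<Rightarrow> bool) \<Rightarrow> 'n multiset set \<Rightarrow> 'n multiset" where
  "min_monomial leq A = ord.Least leq (\<lambda>m. m \<in> A)"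

text \<open>Leading monomials and coefficients are only meaningful for non-zero series.\<close>
definition lm ::
    "('n multiset \<Rightarrow> 'n multiset \<Rightarrow> bool) \<Rightarrow> ('n, 'k :: zero) mfps \<Rightarrow> 'n multiset" where
  "lm leq f = min_monomial leq (supp f)"

definition lc :: "('n multiset \<Rightarrow> 'n multiset \<Rightarrow> bool) \<Rightarrow> ('n, 'k :: zero) mfps \<Rightarrow> 'k" where
  "lc leq f = mcoeff f (lm leq f)"


section \<open>Topological rewriting\<close>

definition normal_forms :: "('a \<Rightarrow> 'a \<Rightarrow> bool) \<Rightarrow> 'a set" where
  "normal_forms rw = {f. \<nexists>g. rw f g}"

definition top_rewrites ::
    "('a \<Rightarrow> 'a \<Rightarrow> bool) \<Rightarrow> 'a :: topological_space \<Rightarrow> 'a \<Rightarrow> bool" where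
  "top_rewrites rw f g \<longleftrightarrow>
     (f, g) \<in> prod_topology (discrete_topology UNIV) euclidean closure_of {(a, b). rw\<^sup>*\<^sup>* a b}"

definition chain_rewrites ::
    "('a \<Rightarrow> 'a \<Rightarrow> bool) \<Rightarrow> 'a :: topological_space \<Rightarrow> 'a \<Rightarrow> bool" where
  "chain_rewrites rw f g \<longleftrightarrow>
     (\<exists>h :: nat \<Rightarrow> 'a. h 0 = f \<and> (\<forall>k. rw\<^sup>=\<^sup>= (h k) (h (Suc k))) \<and> h \<longlonglongrightarrow> g)"

definition fin_top_confluent :: "('a :: topological_space \<Rightarrow> 'a \<Rightarrow> bool) \<Rightarrow> bool" where
  "fin_top_confluent rw \<longleftrightarrow>
     (\<forall>a b c. rw\<^sup>*\<^sup>* a b \<and> rw\<^sup>*\<^sup>* a c \<longrightarrow> (\<exists>d. top_rewrites rw b d \<and> top_rewrites rw c d))"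

definition inf_top_confluent :: "('a :: topological_space \<Rightarrow> 'a \<Rightarrow> bool) \<Rightarrow> bool" where
  "inf_top_confluent rw \<longleftrightarrow>
     (\<forall>a b c. top_rewrites rw a b \<and> top_rewrites rw a c \<longrightarrow>
        (\<exists>d. top_rewrites rw b d \<and> top_rewrites rw c d))"


section \<open>Rewriting modulo power series, and standard bases\<close>

definition reduces_to ::
    "('n multiset \<Rightarrow> 'n multiset \<Rightarrow> bool) \<Rightarrow> nat \<Rightarrow> (nat \<Rightarrow> ('n, 'k :: field) mfps) \<Rightarrow>
     ('n, 'k) mfps \<Rightarrow> ('n, 'k) mfps \<Rightarrow> bool" where
  "reduces_to leq r s f g \<longleftrightarrow>
     (\<exists>M \<in> supp f. \<exists>i \<in> {1..r}. \<exists>m.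
        M = m + lm leq (s i) \<and> g = f - msingle m (mcoeff f M / lc leq (s i)) * s i)"

definition standard_basis ::
    "('n multiset \<Rightarrow> 'n multiset \<Rightarrow> bool) \<Rightarrow> ('n, 'k :: field) mfps set \<Rightarrow>
     ('n, 'k) mfps set \<Rightarrow> bool" where
  "standard_basis leq G I \<longleftrightarrow>
     G \<subseteq> I - {0} \<and> (\<forall>f \<in> I - {0}. \<exists>g \<in> G. \<exists>m. lm leq f = m + lm leq g)"

text \<open>
  Only used for non-zero \<open>f\<close>, so that some \<open>q i\<close> is non-zero and the minimum is taken over a
  non-empty finite set.
\<close>
definition standard_rep ::
    "('n multiset \<Rightarrow> 'n multiset \<Rightarrow> bool) \<Rightarrow> nat \<Rightarrow> (nat \<Rightarrow> ('n, 'k :: field) mfps) \<Rightarrow>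
     ('n, 'k) mfps \<Rightarrow> bool" where
  "standard_rep leq r s f \<longleftrightarrow>
     (\<exists>q. f = (\<Sum>i = 1..r. q i * s i) \<and>
          lm leq f = min_monomial leq {lm leq (q i * s i) | i. i \<in> {1..r} \<and> q i \<noteq> 0})"

abbreviation mfps_ring :: "('n, 'k :: field) mfps ring" where
  "mfps_ring \<equiv> ring_of_type_algebra"

end

theory Submission
  imports Defs
begin

text \<open>
  Reducing one occurring monomial at a time, in increasing order, divides any series \<open>f\<close> by the
  generators: as degree compatibility leaves finitely many monomials below each one, every
  coefficient is treated after finitely many steps, and the remainders converge to a normal form
  congruent to \<open>f\<close> modulo the ideal (\<open>division\<close>).  Hence the statements about normal forms all say
  that zero is the only normal form in the ideal: this makes the remainder zero for each \<open>f\<close> in the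
  ideal, which gives a convergent chain to \<open>0\<close> and, by reading the quotients, a standard
  representation; and since normal forms are closed under differences, it makes remainders unique.

  All conditions are compared with \<open>leads_reducible\<close>: each nonzero element of the ideal has a
  leading monomial divisible by some \<open>lm (s i)\<close>.  If \<open>lm f\<close> is not divisible, its coefficient in \<open>f\<close>
  survives every finite rewriting (\<open>rewriting_keeps_irreducible_lead\<close>), so \<open>f\<close> does not rewrite
  topologically to \<open>0\<close>.  A standard representation exhibits the divisor of \<open>lm f\<close>, because
  \<open>lm (q i * s i) = lm (q i) + lm (s i)\<close> over a field.

  For confluence, \<open>leads_reducible\<close> implies that the ideal is topologically closed
  (\<open>combinations_closed\<close>), so all topological reducts of one series are congruent, and their normal
  forms coincide.  The converse, from finitary confluence, is the delicate direction: topological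
  joins cannot be composed, and an element of the ideal is in general not a finite sum of monomial
  multiples of generators.  Both obstacles disappear when everything is read up to a fixed degree
  \<open>d\<close>.  Finite rewriting is compatible with truncation (\<open>rewriting_lifts\<close>), which makes joinability up
  to degree \<open>d\<close> transitive; and up to degree \<open>d\<close> an element of the ideal is reached from \<open>0\<close> by adding
  finitely many terms \<open>msingle m c * s i\<close>, and a series is joinable with the one obtained by adding
  such a term.  So every \<open>f\<close> in the ideal rewrites to \<open>0\<close> up to every degree.
\<close>

section \<open>Coefficients, truncation and convergence\<close>

lemma mcoeff_simps [simp]:
  "mcoeff 0 m = 0"
  "mcoeff (f + g) m = mcoeff f m + mcoeff g m"
  "mcoeff (f - g) m = mcoeff f m - mcoeff g m"
  "mcoeff (- f) m = - mcoeff f m"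
  "mcoeff (msingle a c) m = (if m = a then c else 0)"
  by (transfer; simp)+

lemma mcoeff_sum [simp]: "mcoeff (sum f A) m = (\<Sum>i \<in> A. mcoeff (f i) m)"
  by (induction A rule: infinite_finite_induct) auto

lemma supp_iff: "m \<in> supp f \<longleftrightarrow> mcoeff f m \<noteq> 0"
  by (simp add: supp_def)

lemma supp_mult_cases:
  fixes f g :: "('n, 'k :: comm_ring_1) mfps"
  assumes "m \<in> supp (f * g)"
  obtains a b where "a \<in> supp f" "b \<in> supp g" "m = a + b"
proof -
  have "(\<Sum>x \<in> {(a, b). a + b = m}. mcoeff f (fst x) * mcoeff g (snd x)) \<noteq> 0"
    using assms by (simp add: supp_def times_mfps.rep_eq case_prod_unfold)
  then obtain x where "x \<in> {(a, b). a + b = m}" "mcoeff f (fst x) * mcoeff g (snd x) \<noteq> 0"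
    by (rule sum.not_neutral_contains_not_neutral)
  then show thesis
    by (intro that[of "fst x" "snd x"]) (auto simp: supp_def case_prod_unfold)
qed

lemma mcoeff_mult_unique_split:
  fixes f g :: "('n, 'k :: comm_ring_1) mfps"
  assumes "\<And>a' b'. a' \<in> supp f \<Longrightarrow> b' \<in> supp g \<Longrightarrow> a' + b' = a + b \<Longrightarrow> a' = a"
  shows "mcoeff (f * g) (a + b) = mcoeff f a * mcoeff g b"
proof -
  have "mcoeff (f * g) (a + b) = (\<Sum>(x, y) \<in> {(a, b)}. mcoeff f x * mcoeff g y)"
    unfolding times_mfps.rep_eq
  proof (rule sum.mono_neutral_right)
    show "\<forall>x \<in> {(x, y). x + y = a + b} - {(a, b)}.
        (case x of (x, y) \<Rightarrow> mcoeff f x * mcoeff g y) = 0"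
    proof
      fix p assume p: "p \<in> {(x, y). x + y = a + b} - {(a, b)}"
      obtain x y where xy: "p = (x, y)" by fastforce
      with p have "x + y = a + b" "x \<noteq> a" by auto
      with assms[of x y] have "mcoeff f x = 0 \<or> mcoeff g y = 0"
        by (auto simp: supp_def)
      then show "(case p of (x, y) \<Rightarrow> mcoeff f x * mcoeff g y) = 0" by (auto simp: xy)
    qed
  qed (simp_all add: finite_splits)
  then show ?thesis by simp
qed

lemma mcoeff_msingle_mult_add:
  "mcoeff (msingle a c * g) (a + b) = c * mcoeff g b"
  by (subst mcoeff_mult_unique_split) (auto simp: supp_def split: if_splits)

lemma supp_msingle_mult:
  assumes "m \<in> supp (msingle a c * g)"
  obtains b where "b \<in> supp g" "m = a + b"
  using supp_mult_cases[OF assms] that by (metis mcoeff_simps(5) supp_iff)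

lemma finite_monomials_size_le: "finite {m :: 'n :: finite multiset. size m \<le> d}"
proof -
  have "{m :: 'n multiset. size m \<le> d} \<subseteq> mset ` {xs. set xs \<subseteq> UNIV \<and> length xs \<le> d}"
  proof
    fix m :: "'n multiset"
    assume "m \<in> {m. size m \<le> d}"
    moreover obtain xs where "mset xs = m" using ex_mset by blast
    ultimately show "m \<in> mset ` {xs. set xs \<subseteq> UNIV \<and> length xs \<le> d}" by force
  qed
  then show ?thesis
    by (rule finite_subset) (intro finite_imageI finite_lists_length_le finite)
qed

text \<open>
  Agreement up to degree \<open>d\<close> is the open ball of radius \<open>2\<close> to the power \<open>-d\<close>; working with it avoids
  valuations, which have no meaning for the zero series.
\<close>
definition agree :: "nat \<Rightarrow> ('n, 'k) mfps \<Rightarrow> ('n, 'k) mfps \<Rightarrow> bool" where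
  "agree d f g \<longleftrightarrow> (\<forall>m. size m \<le> d \<longrightarrow> mcoeff f m = mcoeff g m)"

lemma agree_refl [simp]: "agree d f f"
  and agree_sym: "agree d f g \<Longrightarrow> agree d g f"
  and agree_trans: "agree d f g \<Longrightarrow> agree d g h \<Longrightarrow> agree d f h"
  by (auto simp: agree_def)

lemma agree_add: "agree d f f' \<Longrightarrow> agree d g g' \<Longrightarrow> agree d (f + g) (f' + g')"
  by (auto simp: agree_def)

lemma agree_diff: "agree d f f' \<Longrightarrow> agree d g g' \<Longrightarrow> agree d (f - g) (f' - g')"
  by (auto simp: agree_def)

lemma agree_sum: "(\<And>i. i \<in> A \<Longrightarrow> agree d (f i) (g i)) \<Longrightarrow> agree d (sum f A) (sum g A)"
  by (auto simp: agree_def intro: sum.cong)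

lemma agree_mult: "agree d f f' \<Longrightarrow> agree d (f * g) (f' * g)"
  by (auto simp: agree_def times_mfps.rep_eq intro!: sum.cong)

lemma mfps_eq_if_agree: "(\<And>d. agree d f g) \<Longrightarrow> f = g"
  by (rule mfps_eqI) (auto simp: agree_def)

lemma agree_iff_dist_less: "agree d f g \<longleftrightarrow> dist f g < inverse (2 ^ d)"
proof (cases "f = g")
  case False
  have "agree d f g \<longleftrightarrow> d < mval (f - g)"
  proof
    assume "agree d f g"
    moreover obtain m where "m \<in> supp (f - g)" "size m = mval (f - g)"
      using False mval_attained[of "f - g"] by auto
    ultimately show "d < mval (f - g)" by (force simp: agree_def supp_def)
  next
    assume "d < mval (f - g)"
    then show "agree d f g"
      using mval_le[of _ "f - g"] by (fastforce simp: agree_def supp_def)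
  qed
  with False show ?thesis by (simp add: dist_mfps_def)
qed (simp add: dist_mfps_def)

text \<open>
  As there are finitely many monomials of each degree, coefficientwise stabilisation is convergence
  for the metric.
\<close>
lemma eventually_agree:
  fixes h :: "nat \<Rightarrow> ('n :: finite, 'k) mfps"
  assumes "\<And>m. \<forall>\<^sub>F k in sequentially. mcoeff (h k) m = mcoeff g m"
  shows "\<forall>\<^sub>F k in sequentially. agree d (h k) g"
proof -
  have "\<forall>\<^sub>F k in sequentially. \<forall>m \<in> {m. size m \<le> d}. mcoeff (h k) m = mcoeff g m"
    by (intro eventually_ball_finite finite_monomials_size_le ballI assms)
  then show ?thesis by eventually_elim (simp add: agree_def)
qed

lemma tendsto_iff_eventually_agree:
  fixes h :: "nat \<Rightarrow> ('n, 'k :: ab_group_add) mfps"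
  shows "h \<longlonglongrightarrow> g \<longleftrightarrow> (\<forall>d. \<forall>\<^sub>F k in sequentially. agree d (h k) g)"
proof
  assume "h \<longlonglongrightarrow> g"
  then show "\<forall>d. \<forall>\<^sub>F k in sequentially. agree d (h k) g"
    by (simp add: tendsto_iff agree_iff_dist_less)
next
  assume *: "\<forall>d. \<forall>\<^sub>F k in sequentially. agree d (h k) g"
  show "h \<longlonglongrightarrow> g"
  proof (rule tendstoI)
    fix e :: real assume "0 < e"
    then obtain d where "inverse (2 ^ d) < e"
      using real_arch_pow_inv[of e "1 / 2"] by (auto simp: power_one_over inverse_eq_divide)
    with * show "\<forall>\<^sub>F k in sequentially. dist (h k) g < e"
      by (auto simp: agree_iff_dist_less elim!: eventually_mono[OF spec[of _ d]])
  qed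
qed

lemma mcoeff_stabilises:
  assumes "\<And>k. k0 \<le> k \<Longrightarrow> mcoeff (h (Suc k)) m = mcoeff (h k) m" and "k0 \<le> k"
  shows "mcoeff (h k) m = mcoeff (h k0) m"
  using assms(2)
proof (induction k rule: dec_induct)
  case (step n)
  with assms(1)[of n] show ?case by simp
qed simp

lemma coefficientwise_limit_exists:
  assumes "\<And>m k. K m \<le> k \<Longrightarrow> mcoeff (h (Suc k)) m = mcoeff (h k) m"
  obtains g where "\<And>m k. K m \<le> k \<Longrightarrow> mcoeff (h k) m = mcoeff g m"
proof
  show "mcoeff (h k) m = mcoeff (Abs_mfps (\<lambda>m. mcoeff (h (K m)) m)) m" if "K m \<le> k" for m k
    using mcoeff_stabilises[of "K m" h m k] assms that by (simp add: Abs_mfps_inverse)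
qed

text \<open>
  The discrete topology fixes the first component, so only the second one is approximated.
\<close>
lemma top_rewrites_iff:
  fixes f g :: "('n, 'k :: ab_group_add) mfps"
  shows "top_rewrites rw f g \<longleftrightarrow> (\<forall>d. \<exists>b. rw\<^sup>*\<^sup>* f b \<and> agree d b g)"
proof
  assume top: "top_rewrites rw f g"
  show "\<forall>d. \<exists>b. rw\<^sup>*\<^sup>* f b \<and> agree d b g"
  proof
    fix d
    have "openin (prod_topology (discrete_topology UNIV) euclidean)
        ({f} \<times> ball g (inverse (2 ^ d)))"
      by (simp add: openin_prod_Times_iff)
    then have "\<exists>y. y \<in> {(a, b). rw\<^sup>*\<^sup>* a b} \<and> y \<in> {f} \<times> ball g (inverse (2 ^ d))"
      by (intro top[unfolded top_rewrites_def in_closure_of, THEN conjunct2, rule_format] conjI)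
        simp_all
    then show "\<exists>b. rw\<^sup>*\<^sup>* f b \<and> agree d b g"
      by (auto simp: agree_iff_dist_less dist_commute)
  qed
next
  assume *: "\<forall>d. \<exists>b. rw\<^sup>*\<^sup>* f b \<and> agree d b g"
  show "top_rewrites rw f g"
    unfolding top_rewrites_def in_closure_of
  proof (intro conjI allI impI)
    fix T :: "(('n, 'k) mfps \<times> ('n, 'k) mfps) set"
    assume "(f, g) \<in> T \<and> openin (prod_topology (discrete_topology UNIV) euclidean) T"
    then obtain U V where UV: "f \<in> U" "g \<in> V" "open V" "U \<times> V \<subseteq> T"
      unfolding openin_prod_topology_alt by (auto; metis)
    have "(\<lambda>d. SOME b. rw\<^sup>*\<^sup>* f b \<and> agree d b g) \<longlonglongrightarrow> g" (is "?b \<longlonglongrightarrow> g")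
      unfolding tendsto_iff_eventually_agree
    proof
      fix d
      have "agree d (?b k) g" if "d \<le> k" for k
        using someI_ex[OF *[rule_format, of k]] that by (auto simp: agree_def)
      then show "\<forall>\<^sub>F k in sequentially. agree d (?b k) g"
        by (auto simp: eventually_sequentially)
    qed
    from topological_tendstoD[OF this UV(3,2)] obtain k where "?b k \<in> V"
      unfolding eventually_sequentially by blast
    moreover have "rw\<^sup>*\<^sup>* f (?b k)" using someI_ex[OF *[rule_format, of k]] by blast
    ultimately show "\<exists>y. y \<in> {(a, b). rw\<^sup>*\<^sup>* a b} \<and> y \<in> T" using UV(1,4) by blast
  qed simp
qed

lemma top_rewritesI: "rw\<^sup>*\<^sup>* f g \<Longrightarrow> top_rewrites rw f g"
  for f g :: "('n, 'k :: ab_group_add) mfps"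
  by (auto simp: top_rewrites_iff)

lemma chain_rewrites_imp_top_rewrites:
  fixes f g :: "('n, 'k :: ab_group_add) mfps"
  assumes "chain_rewrites rw f g"
  shows "top_rewrites rw f g"
proof -
  obtain h where h: "h 0 = f" "\<And>k. rw\<^sup>=\<^sup>= (h k) (h (Suc k))" "h \<longlonglongrightarrow> g"
    using assms by (auto simp: chain_rewrites_def)
  have "rw\<^sup>*\<^sup>* f (h k)" for k
  proof (induction k)
    case (Suc k)
    with h(2)[of k] show ?case by (auto intro: rtranclp.rtrancl_into_rtrancl)
  qed (simp add: h(1))
  then show ?thesis
    using h(3) unfolding tendsto_iff_eventually_agree top_rewrites_iff eventually_sequentially
    by blast
qed

section \<open>Leading monomials\<close>

locale degree_order =
  fixes leq :: "'n :: finite multiset \<Rightarrow> 'n multiset \<Rightarrow> bool"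
  assumes monomial_order: "monomial_order leq"
    and degree_compatible: "degree_compatible leq"
begin

abbreviation less where "less a b \<equiv> leq a b \<and> a \<noteq> b"

text \<open>
  The position of a monomial in the increasing enumeration of all monomials.  It is meaningful
  because degree compatibility leaves only finitely many monomials below a given one.
\<close>
definition rank :: "'n multiset \<Rightarrow> nat" where
  "rank m = card {a. less a m}"

lemma size_mono: "leq a b \<Longrightarrow> size a \<le> size b"
proof (rule ccontr)
  have antisym: "antisym {(a, b). leq a b}"
    using monomial_order
    by (simp add: monomial_order_def linear_order_on_def partial_order_on_def)
  assume "leq a b" "\<not> size a \<le> size b"
  moreover from this(2) have "leq b a" "b \<noteq> a"
    using degree_compatible by (auto simp: degree_compatible_def)
  ultimately show False using antisymD[OF antisym, of a b] by simp
qed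

lemma finite_less: "finite {a. less a m}"
  by (rule finite_subset[OF _ finite_monomials_size_le[of "size m"]]) (auto dest: size_mono)

lemma rank_strict_mono: "less a b \<Longrightarrow> rank a < rank b"
  unfolding rank_def
proof (rule psubset_card_mono[OF finite_less])
  have "trans {(a, b). leq a b}" "antisym {(a, b). leq a b}"
    using monomial_order
    by (auto simp: monomial_order_def linear_order_on_def partial_order_on_def preorder_on_def)
  then show "less a b \<Longrightarrow> {x. less x a} \<subset> {x. less x b}"
    unfolding trans_def antisym_def by blast
qed

sublocale mon: wellorder leq less
proof unfold_locales
  have lin: "refl {(a, b). leq a b}" "trans {(a, b). leq a b}" "antisym {(a, b). leq a b}"
    "total {(a, b). leq a b}"
    using monomial_order
    by (auto simp: monomial_order_def linear_order_on_def partial_order_on_def preorder_on_def)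
  show "leq x x" for x using lin(1) by (auto simp: refl_on_def)
  show "leq x z" if "leq x y" "leq y z" for x y z using lin(2) that by (auto simp: trans_def)
  show "x = y" if "leq x y" "leq y x" for x y using lin(3) that by (auto simp: antisym_def)
  then show "less x y = (leq x y \<and> \<not> leq y x)" for x y by auto
  show "leq x y \<or> leq y x" for x y
    using lin(1,4) by (cases "x = y") (auto simp: total_on_def refl_on_def)
  show "P a" if step: "\<And>x. (\<And>y. less y x \<Longrightarrow> P y) \<Longrightarrow> P x" for P a
    by (induction a rule: measure_induct_rule[of rank]) (blast intro: step rank_strict_mono)
qed

lemma rank_inj: "rank a = rank b \<Longrightarrow> a = b"
  using rank_strict_mono[of a b] rank_strict_mono[of b a] mon.linear[of a b] by auto

lemma leq_iff_rank: "leq a b \<longleftrightarrow> rank a \<le> rank b"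
proof (cases "a = b")
  case False
  then show ?thesis
    using rank_strict_mono[of a b] rank_strict_mono[of b a] mon.linear[of a b]
    by (cases "leq a b") auto
qed simp

lemma add_left_mono: "leq a b \<Longrightarrow> leq (m + a) (m + b)"
  using monomial_order by (simp add: monomial_order_def)

lemma add_mono: "leq a a' \<Longrightarrow> leq b b' \<Longrightarrow> leq (a + b) (a' + b')"
  using mon.order.trans[OF add_left_mono[of b b' a]] add_left_mono[of a a' b']
  by (simp add: add.commute)

lemma lm_in_supp: "f \<noteq> 0 \<Longrightarrow> lm leq f \<in> supp f"
  unfolding lm_def min_monomial_def by (rule mon.LeastI_ex) (use supp_empty_iff[of f] in auto)

lemma lm_leq: "m \<in> supp f \<Longrightarrow> leq (lm leq f) m"
  unfolding lm_def min_monomial_def by (rule mon.Least_le)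

lemma min_monomial_eqI: "m \<in> A \<Longrightarrow> (\<And>a. a \<in> A \<Longrightarrow> leq m a) \<Longrightarrow> min_monomial leq A = m"
  unfolding min_monomial_def by (rule mon.Least_equality)

lemma lm_eqI: "m \<in> supp f \<Longrightarrow> (\<And>a. a \<in> supp f \<Longrightarrow> leq m a) \<Longrightarrow> lm leq f = m"
  unfolding lm_def by (rule min_monomial_eqI)

lemma lc_nonzero: "f \<noteq> 0 \<Longrightarrow> lc leq f \<noteq> 0"
  using lm_in_supp by (simp add: lc_def supp_iff)

lemma supp_mult_leq:
  fixes f g :: "('n, 'k :: comm_ring_1) mfps"
  assumes "m \<in> supp (f * g)"
  shows "leq (lm leq f + lm leq g) m"
proof -
  obtain a b where "a \<in> supp f" "b \<in> supp g" "m = a + b"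
    using assms by (rule supp_mult_cases)
  then show ?thesis by (simp add: add_mono lm_leq)
qed

text \<open>
  The sum \<open>lm f + lm g\<close> splits in only one way into a monomial of \<open>f\<close> and one of \<open>g\<close>: both
  summands are minimal, and translation preserves strict inequalities.  So its coefficient is
  \<open>lc f * lc g\<close>, which does not vanish over a field.
\<close>
lemma lm_mult:
  fixes f g :: "('n, 'k :: field) mfps"
  assumes "f \<noteq> 0" "g \<noteq> 0"
  shows "lm leq (f * g) = lm leq f + lm leq g"
proof (rule lm_eqI)
  have "mcoeff (f * g) (lm leq f + lm leq g) = lc leq f * lc leq g"
    unfolding lc_def
  proof (rule mcoeff_mult_unique_split)
    fix a b
    assume ab: "a \<in> supp f" "b \<in> supp g" and eq: "a + b = lm leq f + lm leq g"
    have "leq (a + b) (lm leq f + b)"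
      unfolding eq by (intro add_left_mono lm_leq ab)
    moreover have "leq (lm leq f + b) (a + b)"
      by (intro add_mono lm_leq ab mon.order.refl)
    ultimately have "a + b = lm leq f + b" by (rule mon.order.antisym)
    then show "a = lm leq f" by simp
  qed
  with assms show "lm leq f + lm leq g \<in> supp (f * g)" by (simp add: supp_iff lc_nonzero)
qed (rule supp_mult_leq)

end

section \<open>Rewriting and division\<close>

locale power_series_reduction = degree_order leq
  for leq :: "'n :: finite multiset \<Rightarrow> 'n multiset \<Rightarrow> bool" +
  fixes r :: nat and s :: "nat \<Rightarrow> ('n, 'k :: field) mfps"
  assumes s_nonzero: "i \<in> {1..r} \<Longrightarrow> s i \<noteq> 0"
begin

abbreviation rw where "rw \<equiv> reduces_to leq r s"

definition reducible :: "'n multiset \<Rightarrow> bool" where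
  "reducible M \<longleftrightarrow> (\<exists>i \<in> {1..r}. \<exists>m. M = m + lm leq (s i))"

text \<open>
  The ideal generated by the \<open>s i\<close>, in the form in which division produces its elements.
\<close>
definition combinations :: "('n, 'k) mfps set" where
  "combinations = range (\<lambda>q. \<Sum>i = 1..r. q i * s i)"

lemma combinations_zero: "0 \<in> combinations"
  by (auto simp: combinations_def intro: range_eqI[where x = "\<lambda>_. 0"])

lemma combinations_add: "f \<in> combinations \<Longrightarrow> g \<in> combinations \<Longrightarrow> f + g \<in> combinations"
  unfolding combinations_def
  by (auto simp flip: sum.distrib distrib_right intro: range_eqI[where x = "\<lambda>i. p i + q i" for p q])

lemma combinations_mult: "f \<in> combinations \<Longrightarrow> g * f \<in> combinations"
  unfolding combinations_def
  by (auto simp: sum_distrib_left simp flip: mult.assoc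
      intro: range_eqI[where x = "\<lambda>i. g * q i" for q])

lemma combinations_diff: "f \<in> combinations \<Longrightarrow> g \<in> combinations \<Longrightarrow> f - g \<in> combinations"
  using combinations_add[of f "- g"] combinations_mult[of g "- 1"] by simp

lemma generator_in_combinations: "i \<in> {1..r} \<Longrightarrow> s i \<in> combinations"
  unfolding combinations_def
  by (rule range_eqI[where x = "\<lambda>j. if j = i then 1 else 0"])
    (simp add: if_distrib[of "\<lambda>x. x * _"] cong: if_cong)

lemma supp_shifted_generator:
  assumes "a \<in> supp (msingle m c * s i)"
  shows "leq (m + lm leq (s i)) a"
proof -
  obtain b where "b \<in> supp (s i)" "a = m + b"
    using assms by (rule supp_msingle_mult)
  then show ?thesis by (simp add: add_left_mono lm_leq)
qed

lemma mcoeff_shifted_generator: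
  "i \<in> {1..r} \<Longrightarrow> mcoeff (msingle m (c / lc leq (s i)) * s i) (m + lm leq (s i)) = c"
  using lc_nonzero[OF s_nonzero] by (simp add: mcoeff_msingle_mult_add lc_def)

lemma mcoeff_below_shifted_generator:
  "rank a < rank (m + lm leq (s i)) \<Longrightarrow> mcoeff (msingle m c * s i) a = 0"
  using supp_shifted_generator[of a m c i] by (auto simp: supp_iff leq_iff_rank)

lemma rwI:
  "m + lm leq (s i) \<in> supp f \<Longrightarrow> i \<in> {1..r} \<Longrightarrow>
    rw f (f - msingle m (mcoeff f (m + lm leq (s i)) / lc leq (s i)) * s i)"
  unfolding reduces_to_def by blast

lemma normal_forms_iff: "f \<in> normal_forms rw \<longleftrightarrow> (\<forall>M \<in> supp f. \<not> reducible M)"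
  unfolding normal_forms_def reduces_to_def reducible_def by blast

lemma zero_in_normal_forms: "0 \<in> normal_forms rw"
  by (simp add: normal_forms_iff supp_def)

lemma normal_forms_diff:
  "f \<in> normal_forms rw \<Longrightarrow> g \<in> normal_forms rw \<Longrightarrow> f - g \<in> normal_forms rw"
  unfolding normal_forms_iff by (auto simp: supp_iff)

text \<open>
  A step at the monomial \<open>M\<close> clears the coefficient of \<open>M\<close> and changes no smaller one.
  If nothing smaller than the irreducible monomial \<open>L\<close> occurs, then \<open>M\<close> is larger than \<open>L\<close>.
\<close>
lemma rewriting_keeps_irreducible_lead:
  assumes "rw\<^sup>*\<^sup>* f g" "\<not> reducible L" "\<forall>M \<in> supp f. leq L M"
  shows "mcoeff g L = mcoeff f L \<and> (\<forall>M \<in> supp g. leq L M)"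
  using assms(1)
proof (induction rule: rtranclp_induct)
  case (step g h)
  from step.hyps(2) obtain m i where mi: "i \<in> {1..r}" "m + lm leq (s i) \<in> supp g"
    and h: "h = g - msingle m (mcoeff g (m + lm leq (s i)) / lc leq (s i)) * s i" (is "_ = _ - ?t")
    by (auto simp: reduces_to_def)
  have "leq L (m + lm leq (s i))" using mi step.IH by blast
  moreover have "L \<noteq> m + lm leq (s i)" using mi(1) assms(2) by (auto simp: reducible_def)
  ultimately have "rank L < rank (m + lm leq (s i))" by (simp add: rank_strict_mono)
  then have "mcoeff ?t L = 0" "\<forall>M \<in> supp ?t. leq L M"
    using supp_shifted_generator[of _ m _ i]
    by (force simp: mcoeff_below_shifted_generator leq_iff_rank)+
  then show ?case using step.IH unfolding h by (auto simp: supp_iff)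
qed (simp add: assms(3))

text \<open>
  The situation once the monomials of rank below \<open>k\<close> have been treated: \<open>h\<close> is the current remainder
  and \<open>q\<close> are the current quotients.  The lower bound \<open>L\<close> of the support of \<open>f\<close> is carried along
  because standard representations need to know that no product \<open>q i * s i\<close> starts below \<open>lm f\<close>.
\<close>
definition division_state where
  "division_state f L k x \<longleftrightarrow> (case x of (h, q) \<Rightarrow>
     f = h + (\<Sum>i = 1..r. q i * s i) \<and>
     (\<forall>m \<in> supp h. rank m < k \<longrightarrow> \<not> reducible m) \<and>
     (\<forall>m \<in> supp h. leq L m) \<and>
     (\<forall>i \<in> {1..r}. \<forall>m \<in> supp (q i). leq L (m + lm leq (s i))))"

text \<open>
  A coefficient of \<open>q i\<close> at \<open>m\<close> is set when the monomial \<open>m + lm (s i)\<close> is treated, so this monomial,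
  not \<open>m\<close>, tells from which stage on it is final.
\<close>
definition division_step where
  "division_step k x y \<longleftrightarrow> (case x of (h, q) \<Rightarrow> case y of (h', q') \<Rightarrow>
     rw\<^sup>=\<^sup>= h h' \<and>
     (\<forall>m. rank m < k \<longrightarrow> mcoeff h' m = mcoeff h m) \<and>
     (\<forall>i \<in> {1..r}. \<forall>m. rank (m + lm leq (s i)) < k \<longrightarrow> mcoeff (q' i) m = mcoeff (q i) m))"

lemma division_step_exists:
  assumes "division_state f L k x"
  shows "\<exists>y. division_state f L (Suc k) y \<and> division_step k x y"
proof -
  obtain h q where x: "x = (h, q)" by fastforce
  note st = assms[unfolded x division_state_def split]
  show ?thesis
  proof (cases "\<exists>M \<in> supp h. rank M = k \<and> reducible M")
    case False
    then have "division_state f L (Suc k) (h, q)"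
      using st by (auto simp: division_state_def less_Suc_eq)
    then show ?thesis by (auto simp: x division_step_def)
  next
    case True
    then obtain i m where im: "m + lm leq (s i) \<in> supp h" "rank (m + lm leq (s i)) = k" "i \<in> {1..r}"
      by (auto simp: reducible_def)
    define c where "c = mcoeff h (m + lm leq (s i)) / lc leq (s i)"
    define h' where "h' = h - msingle m c * s i"
    define q' where "q' = q(i := q i + msingle m c)"
    have L: "leq L (m + lm leq (s i))" using st im(1) by blast
    have below: "mcoeff h' a = mcoeff h a" if "rank a < k" for a
      using that im(2) by (simp add: h'_def mcoeff_below_shifted_generator)
    have at: "mcoeff h' a = 0" if "rank a = k" for a
      using rank_inj[of a "m + lm leq (s i)"] that im
      by (simp add: h'_def c_def mcoeff_shifted_generator)
    have "(\<Sum>j = 1..r. q' j * s j)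
        = (\<Sum>j = 1..r. q j * s j + (if j = i then msingle m c * s i else 0))"
      by (rule sum.cong) (auto simp: q'_def distrib_right)
    also have "\<dots> = (\<Sum>j = 1..r. q j * s j) + msingle m c * s i"
      using im(3) by (simp add: sum.distrib)
    finally have "f = h' + (\<Sum>j = 1..r. q' j * s j)"
      using st by (simp add: h'_def)
    moreover have "\<forall>a \<in> supp h'. rank a < Suc k \<longrightarrow> \<not> reducible a"
      using st below at by (auto simp: less_Suc_eq supp_iff)
    moreover have "\<forall>a \<in> supp h'. leq L a"
    proof
      fix a assume "a \<in> supp h'"
      then have "a \<in> supp h \<or> a \<in> supp (msingle m c * s i)" by (auto simp: h'_def supp_iff)
      then show "leq L a"
        using st L supp_shifted_generator[of a m c i] mon.order.trans by blast
    qed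
    moreover have "\<forall>j \<in> {1..r}. \<forall>a \<in> supp (q' j). leq L (a + lm leq (s j))"
    proof (intro ballI)
      fix j a assume "j \<in> {1..r}" "a \<in> supp (q' j)"
      then have "a \<in> supp (q j) \<or> j = i \<and> a = m"
        by (auto simp: q'_def supp_iff split: if_splits)
      with st L \<open>j \<in> {1..r}\<close> show "leq L (a + lm leq (s j))" by blast
    qed
    ultimately have "division_state f L (Suc k) (h', q')"
      by (simp add: division_state_def)
    moreover have "rw h h'"
      using rwI[OF im(1,3)] by (simp add: h'_def c_def)
    then have "division_step k x (h', q')"
      using below im(2) by (auto simp: x division_step_def q'_def)
    ultimately show ?thesis by blast
  qed
qed

text \<open>
  Treating the monomials in increasing order freezes each coefficient of the remainder and of the
  quotients after finitely many stages, so all of them converge.  The identity between them passes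
  to the limit because coefficients of degree at most \<open>d\<close> of a product depend only on coefficients
  of degree at most \<open>d\<close> of the factors.
\<close>
theorem division:
  assumes "\<forall>m \<in> supp f. leq L m"
  obtains a q where "a \<in> normal_forms rw" "chain_rewrites rw f a"
    "f = a + (\<Sum>i = 1..r. q i * s i)"
    "\<And>i m. i \<in> {1..r} \<Longrightarrow> m \<in> supp (q i) \<Longrightarrow> leq L (m + lm leq (s i))"
proof -
  have "division_state f L 0 (f, \<lambda>_. 0)"
    using assms by (simp add: division_state_def supp_def)
  then have "\<exists>trace. \<forall>k.
      (division_state f L k (trace k) \<and> (k = 0 \<longrightarrow> trace k = (f, \<lambda>_. 0))) \<and>
      division_step k (trace k) (trace (Suc k))"
    by (intro dependent_nat_choice) (use division_step_exists in auto)
  then obtain trace where trace: "trace 0 = (f, \<lambda>_. 0)" "\<And>k. division_state f L k (trace k)"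
    "\<And>k. division_step k (trace k) (trace (Suc k))"
    by blast
  define h where "h k = fst (trace k)" for k
  define p where "p k = snd (trace k)" for k
  have state: "division_state f L k (h k, p k)"
    and step: "division_step k (h k, p k) (h (Suc k), p (Suc k))" for k
    using trace(2,3)[of k] by (simp_all add: h_def p_def)
  obtain a where a: "\<And>m k. Suc (rank m) \<le> k \<Longrightarrow> mcoeff (h k) m = mcoeff a m"
    by (rule coefficientwise_limit_exists[of "\<lambda>m. Suc (rank m)" h])
      (use step in \<open>auto simp: division_step_def\<close>)
  have "\<exists>g. \<forall>m k. Suc (rank (m + lm leq (s i))) \<le> k \<longrightarrow> mcoeff (p k i) m = mcoeff g m"
    if "i \<in> {1..r}" for i
    by (rule coefficientwise_limit_exists[of "\<lambda>m. Suc (rank (m + lm leq (s i)))" "\<lambda>k. p k i"])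
      (use step that in \<open>auto simp: division_step_def\<close>)
  then obtain q where q: "\<And>i m k. i \<in> {1..r} \<Longrightarrow> Suc (rank (m + lm leq (s i))) \<le> k \<Longrightarrow>
      mcoeff (p k i) m = mcoeff (q i) m"
    by metis
  have lim_h: "\<forall>\<^sub>F k in sequentially. agree d (h k) a" for d
    by (rule eventually_agree) (use a in \<open>auto simp: eventually_sequentially\<close>)
  have lim_p: "\<forall>\<^sub>F k in sequentially. agree d (p k i) (q i)" if "i \<in> {1..r}" for d i
    by (rule eventually_agree) (use q[OF that] in \<open>auto simp: eventually_sequentially\<close>)
  show thesis
  proof
    show "a \<in> normal_forms rw"
      unfolding normal_forms_iff
    proof
      fix M assume "M \<in> supp a"
      then show "\<not> reducible M"
        using state[of "Suc (rank M)"] a[of M "Suc (rank M)"]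
        by (auto simp: division_state_def supp_iff)
    qed
    show "chain_rewrites rw f a"
      unfolding chain_rewrites_def
    proof (intro exI[of _ h] conjI allI)
      show "h 0 = f" by (simp add: h_def trace(1))
      show "rw\<^sup>=\<^sup>= (h k) (h (Suc k))" for k using step[of k] by (simp add: division_step_def)
      show "h \<longlonglongrightarrow> a" using lim_h by (simp add: tendsto_iff_eventually_agree)
    qed
    show "f = a + (\<Sum>i = 1..r. q i * s i)"
    proof (rule mfps_eq_if_agree)
      fix d
      have "\<forall>\<^sub>F k in sequentially. \<forall>i \<in> {1..r}. agree d (p k i) (q i)"
        by (intro eventually_ball_finite ballI lim_p) auto
      with lim_h[of d] have "\<forall>\<^sub>F k in sequentially. agree d f (a + (\<Sum>i = 1..r. q i * s i))"
      proof eventually_elim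
        case (elim k)
        have "f = h k + (\<Sum>i = 1..r. p k i * s i)"
          using state[of k] by (simp add: division_state_def)
        moreover have "agree d \<dots> (a + (\<Sum>i = 1..r. q i * s i))"
          using elim by (intro agree_add agree_sum agree_mult) auto
        ultimately show ?case by simp
      qed
      then show "agree d f (a + (\<Sum>i = 1..r. q i * s i))" by simp
    qed
    show "leq L (m + lm leq (s i))" if "i \<in> {1..r}" "m \<in> supp (q i)" for i m
      using state[of "Suc (rank (m + lm leq (s i)))"]
        q[OF that(1), of m "Suc (rank (m + lm leq (s i)))"] that
      by (auto simp: division_state_def supp_iff)
  qed
qed

corollary normal_form_exists:
  obtains a where "a \<in> normal_forms rw" "chain_rewrites rw f a" "f - a \<in> combinations"
proof -
  obtain a q where "a \<in> normal_forms rw" "chain_rewrites rw f a" "f = a + (\<Sum>i = 1..r. q i * s i)"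
    by (rule division[of f "lm leq f"]) (auto simp: lm_leq)
  then show thesis by (intro that[of a]) (auto simp: combinations_def)
qed

section \<open>The equivalent conditions\<close>

text \<open>
  This condition, rather than confluence, serves as the hub of the equivalences: it is local enough
  to be read off from a single coefficient.
\<close>
definition leads_reducible :: bool where
  "leads_reducible \<longleftrightarrow> (\<forall>f \<in> combinations - {0}. reducible (lm leq f))"

lemma standard_basis_iff: "standard_basis leq (s ` {1..r}) combinations \<longleftrightarrow> leads_reducible"
proof -
  have "s ` {1..r} \<subseteq> combinations - {0}"
  proof
    fix g assume "g \<in> s ` {1..r}"
    then obtain i where "i \<in> {1..r}" "g = s i" by blast
    then show "g \<in> combinations - {0}"
      using s_nonzero[of i] generator_in_combinations[of i] by simp
  qed
  then show ?thesis
    unfolding standard_basis_def leads_reducible_def reducible_def by blast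
qed

lemma leads_reducible_imp_no_normal_form:
  assumes leads_reducible
  shows "\<forall>f \<in> combinations - {0}. f \<notin> normal_forms rw"
proof
  fix f assume f: "f \<in> combinations - {0}"
  then have "lm leq f \<in> supp f" by (simp add: lm_in_supp)
  with f assms show "f \<notin> normal_forms rw"
    unfolding leads_reducible_def normal_forms_iff by blast
qed

lemma no_normal_form_imp_chain:
  assumes "\<forall>f \<in> combinations - {0}. f \<notin> normal_forms rw"
  shows "\<forall>f \<in> combinations. chain_rewrites rw f 0"
proof
  fix f assume f: "f \<in> combinations"
  obtain a where a: "a \<in> normal_forms rw" "chain_rewrites rw f a" "f - a \<in> combinations"
    by (rule normal_form_exists)
  then have "a \<in> combinations" using combinations_diff[OF f a(3)] by simp
  with assms a(1) have "a = 0" by blast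
  with a(2) show "chain_rewrites rw f 0" by simp
qed

text \<open>
  Were \<open>lm f\<close> irreducible, its coefficient would survive all finite rewritings of \<open>f\<close>, so none of
  them would come close to zero.
\<close>
lemma top_rewrites_zero_imp_leads_reducible:
  assumes "\<forall>f \<in> combinations. top_rewrites rw f 0"
  shows leads_reducible
  unfolding leads_reducible_def
proof
  fix f assume f: "f \<in> combinations - {0}"
  show "reducible (lm leq f)"
  proof (rule ccontr)
    assume irr: "\<not> reducible (lm leq f)"
    obtain b where b: "rw\<^sup>*\<^sup>* f b" "agree (size (lm leq f)) b 0"
      using assms f unfolding top_rewrites_iff by blast
    have "mcoeff b (lm leq f) = mcoeff f (lm leq f)"
      using rewriting_keeps_irreducible_lead[OF b(1) irr] lm_leq by blast
    moreover have "mcoeff b (lm leq f) = 0" using b(2) by (simp add: agree_def)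
    ultimately show False using f lm_in_supp[of f] by (simp add: supp_iff)
  qed
qed

text \<open>
  Division lets no product \<open>q i * s i\<close> start below \<open>lm f\<close>.  With remainder zero, the monomial \<open>lm f\<close>
  itself has to come from one of the products.
\<close>
lemma no_normal_form_imp_standard_rep:
  assumes "\<forall>f \<in> combinations - {0}. f \<notin> normal_forms rw"
  shows "\<forall>f \<in> combinations - {0}. standard_rep leq r s f"
proof
  fix f assume f: "f \<in> combinations - {0}"
  obtain a q where a: "a \<in> normal_forms rw" "f = a + (\<Sum>i = 1..r. q i * s i)"
    and low: "\<And>i m. i \<in> {1..r} \<Longrightarrow> m \<in> supp (q i) \<Longrightarrow> leq (lm leq f) (m + lm leq (s i))"
    by (rule division[of f "lm leq f"]) (auto simp: lm_leq)
  have "f - (\<Sum>i = 1..r. q i * s i) \<in> combinations"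
    using f by (intro combinations_diff) (auto simp: combinations_def)
  moreover have "f - (\<Sum>i = 1..r. q i * s i) = a" using a(2) by simp
  ultimately have "a = 0" using assms a(1) by auto
  with a(2) have sum: "f = (\<Sum>i = 1..r. q i * s i)" by simp
  have ge: "leq (lm leq f) (lm leq (q i * s i))" if "i \<in> {1..r}" "q i \<noteq> 0" for i
    using that low[OF that(1) lm_in_supp] by (simp add: lm_mult s_nonzero)
  have "mcoeff f (lm leq f) \<noteq> 0" using f lm_in_supp[of f] by (simp add: supp_iff)
  moreover have "mcoeff f (lm leq f) = (\<Sum>i = 1..r. mcoeff (q i * s i) (lm leq f))"
    using arg_cong[OF sum, of "\<lambda>g. mcoeff g (lm leq f)"] by (simp only: mcoeff_sum)
  ultimately have "(\<Sum>i = 1..r. mcoeff (q i * s i) (lm leq f)) \<noteq> 0" by simp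
  then obtain i where i: "i \<in> {1..r}" "mcoeff (q i * s i) (lm leq f) \<noteq> 0"
    by (rule sum.not_neutral_contains_not_neutral)
  then have q: "q i \<noteq> 0" by auto
  from i(2) have "leq (lm leq (q i * s i)) (lm leq f)" by (intro lm_leq) (simp add: supp_iff)
  then have eq: "lm leq (q i * s i) = lm leq f"
    using ge[OF i(1) q] by (rule mon.order.antisym)
  have "min_monomial leq {lm leq (q i * s i) | i. i \<in> {1..r} \<and> q i \<noteq> 0} = lm leq f"
  proof (rule min_monomial_eqI)
    show "lm leq f \<in> {lm leq (q i * s i) | i. i \<in> {1..r} \<and> q i \<noteq> 0}"
      using i(1) q eq[symmetric] by blast
  qed (use ge in blast)
  then show "standard_rep leq r s f"
    unfolding standard_rep_def by (intro exI[of _ q] conjI sum) (rule sym)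
qed

lemma standard_rep_imp_leads_reducible:
  assumes "\<forall>f \<in> combinations - {0}. standard_rep leq r s f"
  shows leads_reducible
  unfolding leads_reducible_def
proof
  fix f assume f: "f \<in> combinations - {0}"
  then obtain q where q: "f = (\<Sum>i = 1..r. q i * s i)"
    "lm leq f = min_monomial leq {lm leq (q i * s i) | i. i \<in> {1..r} \<and> q i \<noteq> 0}"
    (is "_ = min_monomial leq ?A")
    using assms unfolding standard_rep_def by blast
  have "\<exists>i \<in> {1..r}. q i \<noteq> 0"
  proof (rule ccontr)
    assume "\<not> (\<exists>i \<in> {1..r}. q i \<noteq> 0)"
    then have "(\<Sum>i = 1..r. q i * s i) = 0" by (intro sum.neutral) auto
    with f q(1) show False by simp
  qed
  then have "\<exists>m. m \<in> ?A" by blast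
  then have "min_monomial leq ?A \<in> ?A" unfolding min_monomial_def by (rule mon.LeastI_ex)
  then have "lm leq f \<in> ?A" by (simp only: q(2)[symmetric])
  then obtain i where i: "lm leq f = lm leq (q i * s i)" "i \<in> {1..r}" "q i \<noteq> 0" by blast
  then have "lm leq f = lm leq (q i) + lm leq (s i)" by (simp add: lm_mult s_nonzero)
  with i(2) show "reducible (lm leq f)" unfolding reducible_def by blast
qed

text \<open>
  Being a normal form depends only on the support, so differences of normal forms are normal.
\<close>
lemma normal_forms_congruent_eq:
  assumes "\<forall>f \<in> combinations - {0}. f \<notin> normal_forms rw"
    and "a \<in> normal_forms rw" "b \<in> normal_forms rw" "a - b \<in> combinations"
  shows "a = b"
proof -
  have "a - b \<in> normal_forms rw" using assms(2,3) by (rule normal_forms_diff)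
  with assms(1,4) have "a - b = 0" by blast
  then show ?thesis by simp
qed

lemma ex_combination_iff: "(\<exists>q. f = a + (\<Sum>i = 1..r. q i * s i)) \<longleftrightarrow> f - a \<in> combinations"
  unfolding combinations_def image_iff by (simp add: diff_eq_eq add.commute)

lemma unique_remainder_iff:
  "(\<forall>f. \<exists>!a. a \<in> normal_forms rw \<and> (\<exists>q. f = a + (\<Sum>i = 1..r. q i * s i)))
    \<longleftrightarrow> (\<forall>f \<in> combinations - {0}. f \<notin> normal_forms rw)" (is "?U \<longleftrightarrow> ?N")
proof
  assume U: ?U
  show ?N
  proof
    fix f assume f: "f \<in> combinations - {0}"
    have "\<exists>!a. a \<in> normal_forms rw \<and> f - a \<in> combinations"
      using U unfolding ex_combination_iff by blast
    moreover have "f - 0 \<in> combinations" "f - f \<in> combinations"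
      using f by (auto simp: combinations_zero)
    ultimately show "f \<notin> normal_forms rw"
      using f zero_in_normal_forms by blast
  qed
next
  assume N: ?N
  show ?U
    unfolding ex_combination_iff
  proof (intro allI ex_ex1I)
    show "\<exists>a. a \<in> normal_forms rw \<and> f - a \<in> combinations" for f
      using normal_form_exists[of f] by blast
    show "a = b" if "a \<in> normal_forms rw \<and> f - a \<in> combinations"
      "b \<in> normal_forms rw \<and> f - b \<in> combinations" for f a b
      using that combinations_diff[of "f - b" "f - a"]
      by (intro normal_forms_congruent_eq[OF N]) auto
  qed
qed

section \<open>Confluence\<close>

lemma rewriting_subtracts_combination: "rw\<^sup>*\<^sup>* f g \<Longrightarrow> f - g \<in> combinations"
proof (induction rule: rtranclp_induct)
  case (step g h)
  from step.hyps(2) obtain m c i where i: "i \<in> {1..r}" and h: "h = g - msingle m c * s i"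
    unfolding reduces_to_def by blast
  have "g - h \<in> combinations"
    using combinations_mult[OF generator_in_combinations[OF i], of "msingle m c"] by (simp add: h)
  from combinations_add[OF step.IH this] show ?case by simp
qed (simp add: combinations_zero)

text \<open>
  The remainder \<open>a\<close> of a limit of ideal elements is again such a limit.  If it were nonzero, an ideal
  element agreeing with it up to the degree of \<open>lm a\<close> would have the same leading monomial, because
  monomials of larger degree come later in the order; so \<open>lm a\<close> would be reducible, although \<open>a\<close> is a
  normal form.
\<close>
lemma combinations_closed:
  assumes leads_reducible "\<And>d. \<exists>g \<in> combinations. agree d f g"
  shows "f \<in> combinations"
proof -
  obtain a where a: "a \<in> normal_forms rw" "f - a \<in> combinations"
    by (rule normal_form_exists)
  have "a = 0"
  proof (rule ccontr)
    assume "a \<noteq> 0"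
    then have lead: "lm leq a \<in> supp a" by (rule lm_in_supp)
    obtain g where g: "g \<in> combinations" "agree (size (lm leq a)) f g"
      using assms(2) by blast
    define b where "b = g - (f - a)"
    have b: "b \<in> combinations" unfolding b_def using g(1) a(2) by (rule combinations_diff)
    have "agree (size (lm leq a)) b (f - (f - a))"
      unfolding b_def by (intro agree_diff agree_sym[OF g(2)] agree_refl)
    then have ab: "mcoeff b m = mcoeff a m" if "size m \<le> size (lm leq a)" for m
      using that by (simp add: agree_def)
    have "lm leq b = lm leq a"
    proof (rule lm_eqI)
      show "lm leq a \<in> supp b" using ab lead by (simp add: supp_iff)
      fix m assume m: "m \<in> supp b"
      show "leq (lm leq a) m"
      proof (cases "size m \<le> size (lm leq a)")
        case True
        with ab m have "m \<in> supp a" by (simp add: supp_iff)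
        then show ?thesis by (rule lm_leq)
      next
        case False
        then have "\<not> leq m (lm leq a)" using size_mono[of m "lm leq a"] by auto
        then show ?thesis using mon.linear[of m "lm leq a"] by blast
      qed
    qed
    moreover have "b \<noteq> 0" using ab[of "lm leq a"] lead by (auto simp: supp_iff)
    moreover from this b have "reducible (lm leq b)"
      using assms(1) unfolding leads_reducible_def by simp
    ultimately have "reducible (lm leq a)" by simp
    with a(1) lead show False unfolding normal_forms_iff by blast
  qed
  with a(2) show ?thesis by simp
qed

text \<open>
  Two topological reducts are congruent modulo the ideal by closedness, hence so are the normal
  forms to which division rewrites them, and congruent normal forms are equal.
\<close>
lemma leads_reducible_imp_inf_top_confluent:
  assumes leads_reducible
  shows "inf_top_confluent rw"
  unfolding inf_top_confluent_def
proof (intro allI impI)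
  have diff: "a - b \<in> combinations" if top: "top_rewrites rw a b" for a b
  proof (rule combinations_closed[OF assms])
    fix d
    obtain b' where b': "rw\<^sup>*\<^sup>* a b'" "agree d b' b"
      using top unfolding top_rewrites_iff by blast
    have "agree d (a - b) (a - b')"
      by (rule agree_diff[OF agree_refl agree_sym[OF b'(2)]])
    with rewriting_subtracts_combination[OF b'(1)]
    show "\<exists>g \<in> combinations. agree d (a - b) g" by (rule bexI[rotated])
  qed
  fix a b c assume abc: "top_rewrites rw a b \<and> top_rewrites rw a c"
  obtain b' where b': "b' \<in> normal_forms rw" "chain_rewrites rw b b'" "b - b' \<in> combinations"
    by (rule normal_form_exists)
  obtain c' where c': "c' \<in> normal_forms rw" "chain_rewrites rw c c'" "c - c' \<in> combinations"
    by (rule normal_form_exists)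
  from abc have "top_rewrites rw a b" "top_rewrites rw a c" by auto
  then have "(a - c) + (c - c') - ((a - b) + (b - b')) \<in> combinations"
    by (intro combinations_diff[OF combinations_add combinations_add] diff b'(3) c'(3))
  moreover have "(a - c) + (c - c') - ((a - b) + (b - b')) = b' - c'"
    by (simp add: algebra_simps)
  ultimately have "b' - c' \<in> combinations" by metis
  then have "b' = c'"
    by (rule normal_forms_congruent_eq[OF leads_reducible_imp_no_normal_form[OF assms] b'(1) c'(1)])
  with b'(2) c'(2) have "top_rewrites rw b b'" "top_rewrites rw c b'"
    by (simp_all add: chain_rewrites_imp_top_rewrites)
  then show "\<exists>d. top_rewrites rw b d \<and> top_rewrites rw c d" by blast
qed

lemma inf_imp_fin_top_confluent: "inf_top_confluent rw \<Longrightarrow> fin_top_confluent rw"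
  unfolding inf_top_confluent_def fin_top_confluent_def using top_rewritesI by meson

definition joinable_upto :: "nat \<Rightarrow> ('n, 'k) mfps \<Rightarrow> ('n, 'k) mfps \<Rightarrow> bool" where
  "joinable_upto d f g \<longleftrightarrow> (\<exists>f' g'. rw\<^sup>*\<^sup>* f f' \<and> rw\<^sup>*\<^sup>* g g' \<and> agree d f' g')"

text \<open>
  A step at a monomial of degree at most \<open>d\<close> can be copied; a step at a monomial of larger degree is
  invisible up to degree \<open>d\<close>, since all monomials it touches have at least that degree.
\<close>
lemma rewriting_lifts:
  assumes "rw\<^sup>*\<^sup>* g g'" "agree d f g"
  shows "\<exists>f'. rw\<^sup>*\<^sup>* f f' \<and> agree d f' g'"
  using assms(1)
proof (induction rule: rtranclp_induct)
  case base
  with assms(2) show ?case by blast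
next
  case (step x y)
  then obtain f' where f': "rw\<^sup>*\<^sup>* f f'" "agree d f' x" by blast
  from step.hyps(2) obtain m i where mi: "i \<in> {1..r}" "m + lm leq (s i) \<in> supp x"
    and y: "y = x - msingle m (mcoeff x (m + lm leq (s i)) / lc leq (s i)) * s i" (is "_ = _ - ?t")
    by (auto simp: reduces_to_def)
  show ?case
  proof (cases "size (m + lm leq (s i)) \<le> d")
    case True
    with f'(2) have eq: "mcoeff f' (m + lm leq (s i)) = mcoeff x (m + lm leq (s i))"
      unfolding agree_def by blast
    with mi have "rw f' (f' - ?t)" using rwI[of m i f'] by (simp add: supp_iff)
    with f'(1) have "rw\<^sup>*\<^sup>* f (f' - ?t)" by (rule rtranclp.rtrancl_into_rtrancl)
    moreover have "agree d (f' - ?t) y" unfolding y by (intro agree_diff f'(2) agree_refl)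
    ultimately show ?thesis by blast
  next
    case False
    have "mcoeff ?t a = 0" if "size a \<le> d" for a
    proof (rule ccontr)
      assume "mcoeff ?t a \<noteq> 0"
      then have "size (m + lm leq (s i)) \<le> size a"
        by (intro size_mono supp_shifted_generator) (simp add: supp_iff)
      with that False show False by simp
    qed
    then have "agree d f' y" using f'(2) unfolding y agree_def by simp
    with f'(1) show ?thesis by blast
  qed
qed

text \<open>
  Truncation is what makes the joining relation transitive: topological reducts are replaced by
  finite reducts that agree with them up to degree \<open>d\<close>, and these can be lifted.
\<close>
lemma joinable_upto_trans:
  assumes "fin_top_confluent rw" "joinable_upto d f g" "joinable_upto d g h"
  shows "joinable_upto d f h"
proof -
  obtain f' g1 where f: "rw\<^sup>*\<^sup>* f f'" "rw\<^sup>*\<^sup>* g g1" "agree d f' g1"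
    using assms(2) unfolding joinable_upto_def by blast
  obtain g2 h' where h: "rw\<^sup>*\<^sup>* g g2" "rw\<^sup>*\<^sup>* h h'" "agree d g2 h'"
    using assms(3) unfolding joinable_upto_def by blast
  obtain e where "top_rewrites rw g1 e" "top_rewrites rw g2 e"
    using assms(1) f(2) h(1) unfolding fin_top_confluent_def by blast
  then obtain x y where x: "rw\<^sup>*\<^sup>* g1 x" "agree d x e" and y: "rw\<^sup>*\<^sup>* g2 y" "agree d y e"
    unfolding top_rewrites_iff by blast
  obtain x' where x': "rw\<^sup>*\<^sup>* f' x'" "agree d x' x"
    using rewriting_lifts[OF x(1) f(3)] by blast
  obtain y' where y': "rw\<^sup>*\<^sup>* h' y'" "agree d y' y"
    using rewriting_lifts[OF y(1) agree_sym[OF h(3)]] by blast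
  have "agree d x' y'"
    using agree_trans[OF agree_trans[OF x'(2) x(2)] agree_sym[OF agree_trans[OF y'(2) y(2)]]] .
  with rtranclp_trans[OF f(1) x'(1)] rtranclp_trans[OF h(2) y'(1)] show ?thesis
    unfolding joinable_upto_def by blast
qed

text \<open>
  Both series become the same one when the coefficient of \<open>m + lm (s i)\<close> is cleared with \<open>s i\<close>.
\<close>
lemma joinable_upto_shifted_generator:
  assumes "i \<in> {1..r}"
  shows "joinable_upto d f (f + msingle m c * s i)"
proof -
  define M where "M = m + lm leq (s i)"
  \<comment> \<open>If \<open>M\<close> does not occur in \<open>g\<close>, then \<open>clear g = g\<close>, so this is always at most one step.\<close>
  define clear where "clear g = g - msingle m (mcoeff g M / lc leq (s i)) * s i" for g
  have "rw\<^sup>*\<^sup>* g (clear g)" for g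
  proof (cases "M \<in> supp g")
    case True
    then show ?thesis using rwI[of m i g] assms by (auto simp: clear_def M_def)
  next
    case False
    moreover have "msingle m (0 :: 'k) = 0" by (rule mfps_eqI) simp
    ultimately show ?thesis by (simp add: clear_def supp_iff)
  qed
  moreover have "clear (f + msingle m c * s i) = clear f"
  proof -
    have "mcoeff (f + msingle m c * s i) M / lc leq (s i) = mcoeff f M / lc leq (s i) + c"
      using lc_nonzero[OF s_nonzero[OF assms]]
      by (simp add: M_def mcoeff_msingle_mult_add lc_def add_divide_distrib)
    moreover have "msingle m (a + c) = msingle m a + msingle m c" for a :: 'k
      by (rule mfps_eqI) simp
    ultimately show ?thesis by (simp add: clear_def distrib_right)
  qed
  ultimately have "rw\<^sup>*\<^sup>* f (clear f)" "rw\<^sup>*\<^sup>* (f + msingle m c * s i) (clear f)"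
    by metis+
  then show ?thesis unfolding joinable_upto_def using agree_refl by blast
qed

text \<open>
  Up to terms of degree above \<open>d\<close>, a combination is a finite sum of multiples of generators by
  monomials, and adding one of these at a time is a chain of joinable pairs from \<open>0\<close> to \<open>f\<close>.
  As \<open>0\<close> is a normal form, the resulting join says that \<open>f\<close> rewrites to zero up to degree \<open>d\<close>.
\<close>
lemma fin_top_confluent_imp_top_rewrites_zero:
  assumes "fin_top_confluent rw"
  shows "\<forall>f \<in> combinations. top_rewrites rw f 0"
  unfolding top_rewrites_iff
proof (intro ballI allI)
  fix f d assume "f \<in> combinations"
  then obtain q where q: "f = (\<Sum>i = 1..r. q i * s i)" by (auto simp: combinations_def)
  \<comment> \<open>Quantifying over all \<open>g\<close> is what makes \<open>S\<close> closed under addition.\<close>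
  define S where "S = {u. \<forall>g. joinable_upto d g (g + u)}"
  have small: "u \<in> S" if "agree d u 0" for u
    unfolding S_def joinable_upto_def
  proof (intro CollectI allI exI conjI)
    show "agree d g (g + u)" for g using that by (simp add: agree_def)
  qed auto
  have add: "u + v \<in> S" if "u \<in> S" "v \<in> S" for u v
    unfolding S_def
  proof (intro CollectI allI)
    fix g
    have "joinable_upto d g (g + u)" "joinable_upto d (g + u) (g + u + v)"
      using that by (auto simp: S_def)
    from joinable_upto_trans[OF assms this] show "joinable_upto d g (g + (u + v))"
      by (simp add: add.assoc)
  qed
  have sum: "sum u A \<in> S" if "\<And>j. j \<in> A \<Longrightarrow> u j \<in> S" for A :: "'j set" and u
    using that by (induction A rule: infinite_finite_induct) (auto intro: add small)
  have "q i * s i \<in> S" if i: "i \<in> {1..r}" for i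
  proof -
    \<comment> \<open>The polynomial part of \<open>q i\<close> of degree at most \<open>d\<close>.\<close>
    define p where "p = (\<Sum>m \<in> {m. size m \<le> d}. msingle m (mcoeff (q i) m))"
    have "agree d (q i - p) 0"
      by (simp add: agree_def p_def finite_monomials_size_le)
    then have "(q i - p) * s i \<in> S"
      using agree_mult[of d "q i - p" 0 "s i"] by (intro small) simp
    moreover have "p * s i \<in> S"
      unfolding p_def sum_distrib_right
      by (rule sum) (simp add: S_def joinable_upto_shifted_generator[OF i])
    ultimately show ?thesis using add[of "(q i - p) * s i" "p * s i"] by (simp flip: distrib_right)
  qed
  then have "f \<in> S" unfolding q by (rule sum)
  then have "joinable_upto d 0 (0 + f)" unfolding S_def by blast
  then obtain z f' where z: "rw\<^sup>*\<^sup>* 0 z" and f': "rw\<^sup>*\<^sup>* f f'" "agree d z f'"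
    unfolding joinable_upto_def by auto
  have "z = 0"
    using z
  proof (cases rule: converse_rtranclpE)
    case (step y)
    with zero_in_normal_forms show ?thesis by (simp add: normal_forms_def)
  qed simp
  with f' show "\<exists>b. rw\<^sup>*\<^sup>* f b \<and> agree d b 0" using agree_sym by blast
qed

section \<open>The quotient ring\<close>

lemma genideal_eq_combinations: "Idl\<^bsub>mfps_ring\<^esub> (s ` {1..r}) = combinations"
proof -
  interpret P: cring "mfps_ring :: ('n, 'k) mfps ring" by (rule cring_from_type_algebra)
  have carrier: "carrier (mfps_ring :: ('n, 'k) mfps ring) = UNIV"
    by (simp add: ring_of_type_algebra_def)
  show ?thesis
  proof
    have "ideal combinations (mfps_ring :: ('n, 'k) mfps ring)"
    proof (rule idealI[OF P.ring_axioms])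
      show "subgroup combinations (add_monoid (mfps_ring :: ('n, 'k) mfps ring))"
      proof (rule P.add.subgroupI)
        show "\<ominus>\<^bsub>mfps_ring\<^esub> a \<in> combinations" if "a \<in> combinations" for a
        proof -
          have "\<ominus>\<^bsub>mfps_ring\<^esub> a = - a"
            by (rule P.minus_equality) (auto simp: ring_of_type_algebra_def)
          with that show ?thesis using combinations_mult[of a "- 1"] by simp
        qed
      qed (use combinations_zero in \<open>auto simp: ring_of_type_algebra_def combinations_add\<close>)
      show "x \<otimes>\<^bsub>mfps_ring\<^esub> a \<in> combinations" "a \<otimes>\<^bsub>mfps_ring\<^esub> x \<in> combinations"
        if "a \<in> combinations" for a x
        using combinations_mult[OF that, of x]
        by (simp_all add: ring_of_type_algebra_def mult.commute[of a x])
    qed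
    then show "Idl\<^bsub>mfps_ring\<^esub> (s ` {1..r}) \<subseteq> combinations"
      by (rule P.genideal_minimal) (auto simp: generator_in_combinations)
  next
    interpret I: ideal "Idl\<^bsub>mfps_ring\<^esub> (s ` {1..r})" "mfps_ring :: ('n, 'k) mfps ring"
      by (rule P.genideal_ideal) (simp add: carrier)
    have "(\<Sum>i \<in> A. q i * s i) \<in> Idl\<^bsub>mfps_ring\<^esub> (s ` {1..r})" if "A \<subseteq> {1..r}" for A q
      using finite_subset[OF that finite_atLeastAtMost] that
    proof (induction A rule: finite_induct)
      case empty
      show ?case using I.zero_closed by (simp add: ring_of_type_algebra_def)
    next
      case (insert i A)
      have "s i \<in> Idl\<^bsub>mfps_ring\<^esub> (s ` {1..r})"
        using P.genideal_self[of "s ` {1..r}"] insert.prems by (auto simp: carrier)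
      from I.I_l_closed[OF this, of "q i"] have "q i * s i \<in> Idl\<^bsub>mfps_ring\<^esub> (s ` {1..r})"
        by (simp add: ring_of_type_algebra_def)
      from I.a_closed[OF this insert.IH] insert.hyps insert.prems show ?case
        by (simp add: ring_of_type_algebra_def)
    qed
    then show "combinations \<subseteq> Idl\<^bsub>mfps_ring\<^esub> (s ` {1..r})"
      by (auto simp: combinations_def)
  qed
qed

lemma coset_eq_iff:
  "combinations +>\<^bsub>mfps_ring\<^esub> a = combinations +>\<^bsub>mfps_ring\<^esub> b \<longleftrightarrow> a - b \<in> combinations"
proof -
  have coset: "combinations +>\<^bsub>mfps_ring\<^esub> x = (\<lambda>h. h + x) ` combinations" for x
    by (auto simp: a_r_coset_def r_coset_def ring_of_type_algebra_def)
  show ?thesis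
    unfolding coset
  proof
    assume "(\<lambda>h. h + a) ` combinations = (\<lambda>h. h + b) ` combinations"
    then have "0 + a \<in> (\<lambda>h. h + b) ` combinations"
      using combinations_zero by blast
    then show "a - b \<in> combinations" by auto
  next
    assume ab: "a - b \<in> combinations"
    have "h + a \<in> (\<lambda>h. h + b) ` combinations" if "h \<in> combinations" for h
      by (rule image_eqI[OF _ combinations_add[OF that ab]]) simp
    moreover have "h + b \<in> (\<lambda>h. h + a) ` combinations" if "h \<in> combinations" for h
      by (rule image_eqI[OF _ combinations_diff[OF that ab]]) simp
    ultimately show "(\<lambda>h. h + a) ` combinations = (\<lambda>h. h + b) ` combinations" by blast
  qed
qed

lemma bij_betw_quotient_iff:
  "bij_betw (\<lambda>a. combinations +>\<^bsub>mfps_ring\<^esub> a) (normal_forms rw)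
      (carrier (mfps_ring Quot combinations))
    \<longleftrightarrow> (\<forall>f \<in> combinations - {0}. f \<notin> normal_forms rw)" (is "?B \<longleftrightarrow> ?N")
proof
  assume B: ?B
  show ?N
  proof
    fix f assume f: "f \<in> combinations - {0}"
    then have "combinations +>\<^bsub>mfps_ring\<^esub> f = combinations +>\<^bsub>mfps_ring\<^esub> 0"
      by (simp add: coset_eq_iff)
    with B f show "f \<notin> normal_forms rw"
      using zero_in_normal_forms unfolding bij_betw_def inj_on_def by blast
  qed
next
  assume N: ?N
  have carrier: "carrier (mfps_ring Quot combinations) = range (\<lambda>a. combinations +>\<^bsub>mfps_ring\<^esub> a)"
    by (auto simp: FactRing_def A_RCOSETS_def' ring_of_type_algebra_def)
  show ?B
    unfolding bij_betw_def carrier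
  proof (intro conjI subset_antisym subsetI)
    show "inj_on (\<lambda>a. combinations +>\<^bsub>mfps_ring\<^esub> a) (normal_forms rw)"
      by (rule inj_onI) (auto simp: coset_eq_iff intro: normal_forms_congruent_eq[OF N])
    fix C assume "C \<in> range (\<lambda>a. combinations +>\<^bsub>mfps_ring\<^esub> a)"
    then obtain f where f: "C = combinations +>\<^bsub>mfps_ring\<^esub> f" by blast
    obtain a where "a \<in> normal_forms rw" "f - a \<in> combinations"
      by (rule normal_form_exists)
    then show "C \<in> (\<lambda>a. combinations +>\<^bsub>mfps_ring\<^esub> a) ` normal_forms rw"
      using coset_eq_iff[of f a] f by blast
  qed auto
qed

end

section \<open>The equivalence theorem\<close>

theorem theorem25:
  fixes leq :: "'n :: finite multiset \<Rightarrow> 'n multiset \<Rightarrow> bool"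
    and r :: nat
    and s :: "nat \<Rightarrow> ('n, 'k :: field) mfps"
    and R I :: "('n, 'k) mfps set"
    and rw :: "('n, 'k) mfps \<Rightarrow> ('n, 'k) mfps \<Rightarrow> bool"
  assumes "monomial_order leq" and "admissible leq" and "degree_compatible leq"
    and "R = s ` {1..r}" and "inj_on s {1..r}" and "0 \<notin> R"
    and "I = Idl\<^bsub>mfps_ring\<^esub> R"
    and "rw = reduces_to leq r s"
  shows
    "(fin_top_confluent rw \<longleftrightarrow> (\<forall>f \<in> I. top_rewrites rw f 0)) \<and>
     (fin_top_confluent rw \<longleftrightarrow> (\<forall>f \<in> I - {0}. f \<notin> normal_forms rw)) \<and>
     (fin_top_confluent rw \<longleftrightarrow> standard_basis leq R I) \<and>
     (fin_top_confluent rw \<longleftrightarrow> (\<forall>f \<in> I. chain_rewrites rw f 0)) \<and>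
     (fin_top_confluent rw \<longleftrightarrow> (\<forall>f \<in> I - {0}. standard_rep leq r s f)) \<and>
     (fin_top_confluent rw \<longleftrightarrow>
        (\<forall>f. \<exists>!\<alpha>. \<alpha> \<in> normal_forms rw \<and> (\<exists>q. f = \<alpha> + (\<Sum>i = 1..r. q i * s i)))) \<and>
     (fin_top_confluent rw \<longleftrightarrow>
        bij_betw (\<lambda>\<alpha>. I +>\<^bsub>mfps_ring\<^esub> \<alpha>) (normal_forms rw) (carrier (mfps_ring Quot I))) \<and>
     (fin_top_confluent rw \<longleftrightarrow> inf_top_confluent rw)"
proof -
  interpret P: power_series_reduction leq r s
  proof
    show "s i \<noteq> 0" if "i \<in> {1..r}" for i
      using assms(4,6) that by force
  qed (fact assms)+
  have I: "I = P.combinations"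
    unfolding assms(7,4) by (rule P.genideal_eq_combinations)
  have fin_top: "fin_top_confluent rw \<Longrightarrow> \<forall>f \<in> I. top_rewrites rw f 0"
    unfolding I assms(8) by (rule P.fin_top_confluent_imp_top_rewrites_zero)
  have top_lead: "\<forall>f \<in> I. top_rewrites rw f 0 \<Longrightarrow> P.leads_reducible"
    unfolding I assms(8) by (rule P.top_rewrites_zero_imp_leads_reducible)
  have lead_nf: "P.leads_reducible \<Longrightarrow> \<forall>f \<in> I - {0}. f \<notin> normal_forms rw"
    unfolding I assms(8) by (rule P.leads_reducible_imp_no_normal_form)
  have nf_chain: "\<forall>f \<in> I - {0}. f \<notin> normal_forms rw \<Longrightarrow> \<forall>f \<in> I. chain_rewrites rw f 0"
    unfolding I assms(8) by (rule P.no_normal_form_imp_chain)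
  have chain_top: "\<forall>f \<in> I. chain_rewrites rw f 0 \<Longrightarrow> \<forall>f \<in> I. top_rewrites rw f 0"
    using chain_rewrites_imp_top_rewrites by blast
  have nf_rep: "\<forall>f \<in> I - {0}. f \<notin> normal_forms rw \<Longrightarrow> \<forall>f \<in> I - {0}. standard_rep leq r s f"
    unfolding I assms(8) by (rule P.no_normal_form_imp_standard_rep)
  have rep_lead: "\<forall>f \<in> I - {0}. standard_rep leq r s f \<Longrightarrow> P.leads_reducible"
    unfolding I by (rule P.standard_rep_imp_leads_reducible)
  have lead_inf: "P.leads_reducible \<Longrightarrow> inf_top_confluent rw"
    unfolding assms(8) by (rule P.leads_reducible_imp_inf_top_confluent)
  have inf_fin: "inf_top_confluent rw \<Longrightarrow> fin_top_confluent rw"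
    unfolding assms(8) by (rule P.inf_imp_fin_top_confluent)
  have lead_iff: "fin_top_confluent rw \<longleftrightarrow> P.leads_reducible"
    using fin_top top_lead lead_inf inf_fin by blast
  have nf_iff: "P.leads_reducible \<longleftrightarrow> (\<forall>f \<in> I - {0}. f \<notin> normal_forms rw)"
    using lead_nf nf_chain chain_top top_lead by blast
  have unique_iff: "(\<forall>f. \<exists>!\<alpha>. \<alpha> \<in> normal_forms rw \<and> (\<exists>q. f = \<alpha> + (\<Sum>i = 1..r. q i * s i)))
      \<longleftrightarrow> (\<forall>f \<in> I - {0}. f \<notin> normal_forms rw)"
    unfolding I assms(8) by (rule P.unique_remainder_iff)
  have bij_iff: "bij_betw (\<lambda>\<alpha>. I +>\<^bsub>mfps_ring\<^esub> \<alpha>) (normal_forms rw) (carrier (mfps_ring Quot I))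
      \<longleftrightarrow> (\<forall>f \<in> I - {0}. f \<notin> normal_forms rw)"
    unfolding I assms(8) by (rule P.bij_betw_quotient_iff)
  show ?thesis
  proof (intro conjI)
    show "fin_top_confluent rw \<longleftrightarrow> (\<forall>f \<in> I. top_rewrites rw f 0)"
      using fin_top top_lead lead_iff by blast
    show "fin_top_confluent rw \<longleftrightarrow> (\<forall>f \<in> I - {0}. f \<notin> normal_forms rw)"
      using lead_iff nf_iff by simp
    show "fin_top_confluent rw \<longleftrightarrow> standard_basis leq R I"
      unfolding lead_iff I assms(4) by (rule P.standard_basis_iff[symmetric])
    show "fin_top_confluent rw \<longleftrightarrow> (\<forall>f \<in> I. chain_rewrites rw f 0)"
      using lead_iff nf_iff nf_chain chain_top top_lead by blast
    show "fin_top_confluent rw \<longleftrightarrow> (\<forall>f \<in> I - {0}. standard_rep leq r s f)"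
      using lead_iff nf_iff nf_rep rep_lead by blast
    show "fin_top_confluent rw \<longleftrightarrow>
        (\<forall>f. \<exists>!\<alpha>. \<alpha> \<in> normal_forms rw \<and> (\<exists>q. f = \<alpha> + (\<Sum>i = 1..r. q i * s i)))"
      unfolding lead_iff nf_iff by (rule unique_iff[symmetric])
    show "fin_top_confluent rw \<longleftrightarrow>
        bij_betw (\<lambda>\<alpha>. I +>\<^bsub>mfps_ring\<^esub> \<alpha>) (normal_forms rw) (carrier (mfps_ring Quot I))"
      unfolding lead_iff nf_iff by (rule bij_iff[symmetric])
    show "fin_top_confluent rw \<longleftrightarrow> inf_top_confluent rw"
      using lead_iff lead_inf inf_fin by blast
  qed
qed

end
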